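(* Let $\mu>0$, $\gamma\ge1$, $v_+>1$ be fixed, and let $v_-=1+\varepsilon^{1/\gamma}$. Let $\mathfrak v_\varepsilon$ be the traveling front profile connecting $v_-$ to $v_+$ (see context), with the shift fixed by setting $\mathfrak v_\varepsilon(0)-1\propto\varepsilon^{\frac{1}{\gamma+1}}$. Let $\bar{\mathfrak v}(\xi)=1$ for $\xi<0$ and $\bar{\mathfrak v}(\xi)=\dfrac{v_+}{1+(v_+-1)e^{-r\xi}}$ for $\xi\ge0$, with $r=\dfrac{v_+}{\mu\sqrt{v_+-1}}$, and let $\bar s=(v_+-1)^{-1/2}$. Then, for $\varepsilon$ small enough: 1. For all $R>0$ there exists a constant $C_R$ (independent of $\varepsilon$) such that $$\|\mathfrak v_\varepsilon-\bar{\mathfrak v}\|_{L^\infty(-R,R)}\le C_R\,\varepsilon^{\frac1{\gamma+1}} .$$ 2. Let $\tilde v$ be the solution of the ODE $$\tilde v'=(\mu\bar s)^{-1}\big(1-\tilde v^{-\gamma}\big),\qquad \tilde v(0)=2 .$$ There exist a parameter $\xi^*=\xi^*_\varepsilon<0$ with $\xi^*=O(\varepsilon^{\frac1{\gamma+1}})$, a number $\xi_{min}=\xi_{min,\varepsilon}<0$ with $\xi_{min}\sim -C'\varepsilon^{\frac1{\gamma+1}}$ as $\varepsilon\to0$ for some constant $C'>0$, and a constant $C>0$ independent of $\varepsilon$, such that $$\left|\mathfrak v_\varepsilon(\xi)-\bar{\mathfrak v}(\xi)-\varepsilon^{1/\gamma}\,\tilde v\!\left(\frac{\xi-\xi^*}{\varepsilon^{1/\gamma}}\right)\right|\le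 C\,\varepsilon^{\frac1{\gamma+1}}|\xi|\qquad\forall\,\xi\in[\xi_{min},0].$$
   Context: For $\varepsilon>0$, $p_\varepsilon(v)=\varepsilon(v-1)^{-\gamma}$ for $v>1$. With $v_-=1+\varepsilon^{1/\gamma}<v_+$ and $s_\varepsilon=\sqrt{-\frac{p_\varepsilon(v_+)-p_\varepsilon(v_-)}{v_+-v_-}}>0$, the profile $\mathfrak v_\varepsilon:\mathbb R\to(v_-,v_+)$ is the specific volume component of the traveling front $(u,v)(t,x)=(\mathfrak u_\varepsilon,\mathfrak v_\varepsilon)(x-s_\varepsilon t)$ of $\partial_tv-\partial_xu=0$, $\partial_tu+\partial_xp_\varepsilon(v)-\mu\partial_x(\frac1v\partial_xu)=0$; equivalently it is the increasing solution, unique up to translation, of $$\mathfrak v_\varepsilon'=\frac{\mathfrak v_\varepsilon}{\mu s_\varepsilon}\Big(s_\varepsilon^2(v_+-\mathfrak v_\varepsilon)+p_\varepsilon(v_+)-p_\varepsilon(\mathfrak v_\varepsilon)\Big),\qquad \mathfrak v_\varepsilon(\pm\infty)=v_\pm .$$ The notation $\mathfrak v_\varepsilon(0)-1\propto\varepsilon^{1/(\gamma+1)}$ means $\mathfrak v_\varepsilon(0)=1+\kappa\,\varepsilon^{1/(\gamma+1)}$ for some fixed constant $\kappa>0$ independent of $\varepsilon$. *)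

theory Defs
  imports "HOL-Probability.Probability"
begin

definition pres :: "real \<Rightarrow> real \<Rightarrow> real \<Rightarrow> real" where
  "pres \<gamma> \<epsilon> v = \<epsilon> * (v - 1) powr (- \<gamma>)"

definition vminus :: "real \<Rightarrow> real \<Rightarrow> real" where
  "vminus \<gamma> \<epsilon> = 1 + \<epsilon> powr (1 / \<gamma>)"

definition speed :: "real \<Rightarrow> real \<Rightarrow> real \<Rightarrow> real" where
  "speed \<gamma> vp \<epsilon> =
     sqrt (- ((pres \<gamma> \<epsilon> vp - pres \<gamma> \<epsilon> (vminus \<gamma> \<epsilon>)) / (vp - vminus \<gamma> \<epsilon>)))"

text \<open>Classical solutions \<open>(u, v)\<close>, as functions of time and space, of
  \<open>v\<^sub>t - u\<^sub>x = 0\<close> and \<open>u\<^sub>t + p(v)\<^sub>x - \<mu> (u\<^sub>x / v)\<^sub>x = 0\<close>. Only the derivatives that occur in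
  the system are required to exist. Since \<^const>\<open>deriv\<close> is a total operator, their existence
  is stated separately.\<close>

definition classical_solution ::
  "real \<Rightarrow> (real \<Rightarrow> real) \<Rightarrow> (real \<Rightarrow> real \<Rightarrow> real) \<Rightarrow> (real \<Rightarrow> real \<Rightarrow> real) \<Rightarrow> bool" where
  "classical_solution \<mu> p u v \<longleftrightarrow>
     (\<forall>t x.
        (\<lambda>\<tau>. v \<tau> x) differentiable (at t) \<and>
        (\<lambda>\<tau>. u \<tau> x) differentiable (at t) \<and>
        (\<lambda>y. u t y) differentiable (at x) \<and>
        (\<lambda>y. p (v t y)) differentiable (at x) \<and>
        (\<lambda>y. 1 / v t y * deriv (\<lambda>z. u t z) y) differentiable (at x) \<and>
        deriv (\<lambda>\<tau>. v \<tau> x) t - deriv (\<lambda>y. u t y) x = 0 \<and>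
        deriv (\<lambda>\<tau>. u \<tau> x) t + deriv (\<lambda>y. p (v t y)) x
          - \<mu> * deriv (\<lambda>y. 1 / v t y * deriv (\<lambda>z. u t z) y) x = 0)"

text \<open>Specific volume component of a traveling front. The velocity component \<open>U\<close> needs no
  condition at infinity, because the first equation forces \<open>U + s V\<close> to be constant. The shift
  is left free here.\<close>

definition front_profile :: "real \<Rightarrow> real \<Rightarrow> real \<Rightarrow> real \<Rightarrow> (real \<Rightarrow> real) \<Rightarrow> bool" where
  "front_profile \<mu> \<gamma> vp \<epsilon> V \<longleftrightarrow>
     (\<exists>U. classical_solution \<mu> (pres \<gamma> \<epsilon>)
            (\<lambda>t x. U (x - speed \<gamma> vp \<epsilon> * t)) (\<lambda>t x. V (x - speed \<gamma> vp \<epsilon> * t))) \<and>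
     (\<forall>\<xi>. vminus \<gamma> \<epsilon> < V \<xi> \<and> V \<xi> < vp) \<and>
     (V \<longlongrightarrow> vminus \<gamma> \<epsilon>) at_bot \<and> (V \<longlongrightarrow> vp) at_top"

definition sbar :: "real \<Rightarrow> real" where
  "sbar vp = (vp - 1) powr (- 1 / 2)"

definition vbar :: "real \<Rightarrow> real \<Rightarrow> real \<Rightarrow> real" where
  "vbar \<mu> vp \<xi> =
     (if \<xi> < 0 then 1
      else vp / (1 + (vp - 1) * exp (- (vp / (\<mu> * sqrt (vp - 1))) * \<xi>)))"

definition Linf_norm_on :: "real set \<Rightarrow> (real \<Rightarrow> real) \<Rightarrow> ereal" where
  "Linf_norm_on S f = esssup (restrict_space lborel S) (\<lambda>x. ereal \<bar>f x\<bar>)"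

definition tilde_solution :: "real \<Rightarrow> real \<Rightarrow> real \<Rightarrow> (real \<Rightarrow> real) \<Rightarrow> bool" where
  "tilde_solution \<mu> \<gamma> vp w \<longleftrightarrow>
     (\<forall>z. (w has_real_derivative inverse (\<mu> * sbar vp) * (1 - w z powr (- \<gamma>))) (at z)) \<and>
     w 0 = 2"

end

theory Submission
  imports Defs
begin

text \<open>Write \<open>\<eta> = \<epsilon> powr (1 / (\<gamma> + 1))\<close> and \<open>\<delta> = \<epsilon> powr (1 / \<gamma>)\<close>. One integration of the momentum
  equation gives an autonomous ODE for the profile. Wherever the profile exceeds 1 by at least a
  multiple of \<open>\<eta>\<close>, the pressure is \<open>O(\<eta>)\<close>, and the ODE is an \<open>O(\<eta>)\<close> perturbation of the logistic
  equation solved by the right branch of the limit profile. On the right of 0 the profile is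
  increasing and starts at distance \<open>O(\<eta>)\<close> from the limit, so a Gronwall estimate applies; on the
  left of 0 it is squeezed between 1 and its value at 0. For the second claim, take the interval
  \<open>[- C' * \<eta>, 0]\<close> with \<open>C'\<close> so small that the profile and the rescaled layer solution both stay at
  distance of order \<open>\<eta>\<close> above 1. There both have derivative \<open>1 / (\<mu> * sbar vp) + O(\<eta>)\<close>, and they
  agree at 0 by the choice of the shift.\<close>

section \<open>Reduction of the traveling front system to a scalar ODE\<close>

definition front_rhs :: "real \<Rightarrow> real \<Rightarrow> real \<Rightarrow> real \<Rightarrow> real \<Rightarrow> real" where
  "front_rhs \<mu> \<gamma> vp \<epsilon> v =
     v / (\<mu> * speed \<gamma> vp \<epsilon>) *
       ((speed \<gamma> vp \<epsilon>)\<^sup>2 * (vp - v) + pres \<gamma> \<epsilon> vp - pres \<gamma> \<epsilon> v)"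

text \<open>L'Hospital's rule gives \<open>f x / x\<close> the limit \<open>l\<close>, while
  convergence of \<open>f\<close> gives the same quotient the limit 0.\<close>

lemma derivative_limit_zero:
  fixes f f' :: "real \<Rightarrow> real"
  assumes der: "\<And>x. (f has_real_derivative f' x) (at x)"
    and f: "(f \<longlongrightarrow> c) at_top" and f': "(f' \<longlongrightarrow> l) at_top"
  shows "l = 0"
proof -
  have 1: "((\<lambda>x. f x / x) \<longlongrightarrow> l) at_top"
  proof (rule lhospital_at_top_at_top)
    show "LIM x at_top. x :> at_top" by (rule filterlim_ident)
    show "\<forall>\<^sub>F x in at_top. (f has_real_derivative f' x) (at x)" using der by simp
    show "\<forall>\<^sub>F x in at_top. ((\<lambda>x. x) has_real_derivative 1) (at x)" by simp
    show "((\<lambda>x. f' x / 1) \<longlongrightarrow> l) at_top" using f' by simp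
  qed simp
  have "((\<lambda>x. f x / x) \<longlongrightarrow> 0) at_top"
    using tendsto_divide_0[OF f filterlim_at_top_imp_at_infinity[OF filterlim_ident]] .
  with 1 show ?thesis
    using tendsto_unique trivial_limit_at_top_linorder by blast
qed

text \<open>The mass equation yields \<open>U' = - s V'\<close>. Inserted into the momentum
  equation, this turns it into a total derivative, so
  \<open>s\<^sup>2 V + p(V) - \<mu> U' / V\<close> is constant. Solving for \<open>V'\<close> gives
  the ODE, with the constant read off at plus infinity.\<close>

lemma front_profile_ode:
  assumes "\<mu> > 0" "vp > 1" and s: "speed \<gamma> vp \<epsilon> > 0" and vm: "vminus \<gamma> \<epsilon> > 1"
    and prof: "front_profile \<mu> \<gamma> vp \<epsilon> V"
  shows "(V has_real_derivative front_rhs \<mu> \<gamma> vp \<epsilon> (V x)) (at x)"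
proof -
  define s where "s = speed \<gamma> vp \<epsilon>"
  have s0: "s > 0" using s s_def by simp
  define p where "p = pres \<gamma> \<epsilon>"
  obtain U where cs: "classical_solution \<mu> p (\<lambda>t x. U (x - s * t)) (\<lambda>t x. V (x - s * t))"
    using prof unfolding front_profile_def s_def p_def by blast
  have bnd: "\<And>x. 1 < V x" and lim: "(V \<longlongrightarrow> vp) at_top"
    using prof vm unfolding front_profile_def by (auto intro: less_trans)
  \<comment> \<open>The position precedes the time among the schematic variables, so this fixes the
    time to 0 and leaves the position free.\<close>
  note cs0 = cs[unfolded classical_solution_def, rule_format, of _ 0]
  \<comment> \<open>The system provides differentiability of \<open>V\<close> only along the time
    direction. The inverse substitution \<open>\<tau> = (x - y) / s\<close> transfers it to the
    profile variable, using that \<open>s\<close> is nonzero.\<close>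
  have shift: "(f has_real_derivative - (d / s)) (at x)"
    if "((\<lambda>\<tau>. f (x - s * \<tau>)) has_real_derivative d) (at 0)" for f :: "real \<Rightarrow> real" and d x
  proof -
    have 1: "((\<lambda>\<tau>. f (x - s * \<tau>)) has_real_derivative d) (at ((x - x) / s))"
      using that by simp
    have 2: "((\<lambda>y. (x - y) / s) has_real_derivative - (1 / s)) (at x)"
      using s0 by (auto intro!: derivative_eq_intros)
    have "((\<lambda>y. f (x - s * ((x - y) / s))) has_real_derivative d * - (1 / s)) (at x)"
      using DERIV_chain2[OF 1 2] .
    then show ?thesis using s0 by simp
  qed
  have Vd: "(V has_real_derivative deriv V x) (at x)" for x
  proof -
    have "(\<lambda>\<tau>. V (x - s * \<tau>)) differentiable (at 0)" using cs0[of x] by simp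
    then show ?thesis
      using shift by (meson DERIV_deriv_iff_real_differentiable real_differentiable_def)
  qed
  have Ud: "(U has_real_derivative deriv U x) (at x)" for x
    using cs0[of x] by (simp add: DERIV_deriv_iff_real_differentiable)
  have dt: "deriv (\<lambda>\<tau>. f (x - s * \<tau>)) 0 = - s * deriv f x"
    if "(f has_real_derivative deriv f x) (at x)" for f :: "real \<Rightarrow> real" and x
  proof (rule DERIV_imp_deriv)
    have 1: "(f has_real_derivative deriv f x) (at (x - s * 0))" using that by simp
    have 2: "((\<lambda>\<tau>. x - s * \<tau>) has_real_derivative - s) (at 0)"
      by (auto intro!: derivative_eq_intros)
    from DERIV_chain2[OF 1 2]
    show "((\<lambda>\<tau>. f (x - s * \<tau>)) has_real_derivative - s * deriv f x) (at 0)"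
      by (simp add: mult.commute)
  qed
  have UV: "deriv U x = - s * deriv V x" for x
    using cs0[of x] dt[OF Vd, of x] by simp
  define Q where "Q = (\<lambda>y. 1 / V y * deriv U y)"
  define P where "P = (\<lambda>y. p (V y))"
  have Qd: "(Q has_real_derivative deriv Q x) (at x)"
    and Pd: "(P has_real_derivative deriv P x) (at x)" for x
    using cs0[of x] unfolding Q_def P_def by (simp_all add: DERIV_deriv_iff_real_differentiable)
  have mom: "- s * deriv U x + deriv P x - \<mu> * deriv Q x = 0" for x
    using cs0[of x] dt[OF Ud, of x] unfolding Q_def P_def by simp
  define H where "H = (\<lambda>x. s\<^sup>2 * V x + P x - \<mu> * Q x)"
  have "(H has_real_derivative 0) (at x)" for x
  proof -
    have "(H has_real_derivative (s\<^sup>2 * deriv V x + deriv P x - \<mu> * deriv Q x)) (at x)"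
      unfolding H_def by (intro DERIV_add DERIV_diff DERIV_cmult Vd Pd Qd)
    also have "s\<^sup>2 * deriv V x + deriv P x - \<mu> * deriv Q x = 0"
      using mom[of x] UV[of x] by (simp add: power2_eq_square)
    finally show ?thesis .
  qed
  then obtain K where K: "\<And>x. H x = K"
    using DERIV_isconst_all[of H] by metis
  have dV: "deriv V x = V x / (\<mu> * s) * (K - s\<^sup>2 * V x - p (V x))" for x
  proof -
    have "K - s\<^sup>2 * V x - p (V x) = \<mu> * s * deriv V x / V x"
      using K[of x] UV[of x] unfolding H_def P_def Q_def by (simp add: field_simps)
    then show ?thesis using s0 \<open>\<mu> > 0\<close> bnd[of x] by (simp add: field_simps)
  qed
  have "((\<lambda>x. deriv V x) \<longlongrightarrow> vp / (\<mu> * s) * (K - s\<^sup>2 * vp - p vp)) at_top"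
    unfolding dV p_def pres_def using \<open>vp > 1\<close> s0 \<open>\<mu> > 0\<close>
    by (intro tendsto_intros lim) auto
  \<comment> \<open>Convergence of the derivative forces its limit to be 0, which identifies the constant.\<close>
  from derivative_limit_zero[OF Vd lim this]
  have "K = s\<^sup>2 * vp + p vp" using \<open>vp > 1\<close> s0 \<open>\<mu> > 0\<close> by simp
  then have "K - s\<^sup>2 * V x - p (V x) = s\<^sup>2 * (vp - V x) + p vp - p (V x)"
    by (simp add: algebra_simps)
  then have "deriv V x = front_rhs \<mu> \<gamma> vp \<epsilon> (V x)"
    using dV[of x] unfolding front_rhs_def s_def[symmetric] p_def[symmetric] by simp
  with Vd[of x] show ?thesis by simp
qed

section \<open>Asymptotics of pressure and speed for small \<epsilon>\<close>

lemma powr_eventually_le: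
  fixes a c :: real
  assumes "a > 0" "c > 0"
  shows "\<forall>\<^sub>F \<epsilon> in at_right 0. \<epsilon> powr a \<le> c"
proof -
  have "((\<lambda>\<epsilon>. \<epsilon> powr a) \<longlongrightarrow> 0) (at_right (0::real))" 
    using tendsto_powr'[OF tendsto_ident_at tendsto_const, of 0 a "{0<..}"] assms(1)
    by (auto simp: eventually_at_filter)
  from order_tendstoD(2)[OF this assms(2)] show ?thesis
    by (rule eventually_mono) simp
qed

text \<open>The choice of the left end state normalizes its pressure, because
  \<open>\<delta> powr (- \<gamma>)\<close> cancels the prefactor \<epsilon>.\<close>

lemma pres_vminus:
  assumes "\<epsilon> > 0" "\<gamma> > 0"
  shows "pres \<gamma> \<epsilon> (vminus \<gamma> \<epsilon>) = 1"
  using assms by (simp add: pres_def vminus_def powr_powr powr_minus)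

text \<open>\<open>sqrt\<close> is odd on the reals, so squaring removes it only for a nonnegative
  radicand; the last two assumptions ensure this.\<close>

lemma speed_squared:
  assumes "\<epsilon> > 0" "\<gamma> > 0" "pres \<gamma> \<epsilon> vp \<le> 1" "vminus \<gamma> \<epsilon> < vp"
  shows "(speed \<gamma> vp \<epsilon>)\<^sup>2 = (1 - pres \<gamma> \<epsilon> vp) / (vp - vminus \<gamma> \<epsilon>)"
proof -
  have "- ((pres \<gamma> \<epsilon> vp - 1) / (vp - vminus \<gamma> \<epsilon>)) = (1 - pres \<gamma> \<epsilon> vp) / (vp - vminus \<gamma> \<epsilon>)"
    by (simp add: minus_divide_left)
  then show ?thesis
    using assms by (simp add: speed_def pres_vminus)
qed

lemma sbar_squared: "vp > 1 \<Longrightarrow> (sbar vp)\<^sup>2 = 1 / (vp - 1)"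
  by (simp add: sbar_def powr_minus_divide powr_half_sqrt power_divide)

lemma sbar_pos: "vp > 1 \<Longrightarrow> sbar vp > 0"
  by (simp add: sbar_def)

lemma sbar_eq: "vp > 1 \<Longrightarrow> sbar vp = 1 / sqrt (vp - 1)"
  using sbar_squared[of vp] sbar_pos[of vp]
  by (metis less_eq_real_def real_sqrt_divide real_sqrt_one real_sqrt_unique)

text \<open>Errors of size \<delta> or \<epsilon> can thus be absorbed into \<eta>.\<close>

lemma powr_exponent_le:
  fixes \<epsilon> :: real
  assumes "0 < \<epsilon>" "\<epsilon> \<le> 1" "\<gamma> > 0"
  shows "\<epsilon> powr (1 / \<gamma>) \<le> \<epsilon> powr (1 / (\<gamma> + 1))" "\<epsilon> \<le> \<epsilon> powr (1 / (\<gamma> + 1))"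
proof -
  show "\<epsilon> powr (1 / \<gamma>) \<le> \<epsilon> powr (1 / (\<gamma> + 1))"
    using assms by (intro powr_mono') (auto simp: field_simps)
  have "\<epsilon> powr 1 \<le> \<epsilon> powr (1 / (\<gamma> + 1))"
    using assms by (intro powr_mono') (auto simp: field_simps)
  then show "\<epsilon> \<le> \<epsilon> powr (1 / (\<gamma> + 1))" using assms by simp
qed

text \<open>This is the origin of the exponent: \<eta> is the scale at which
  \<open>\<epsilon> * \<eta> powr (- \<gamma>)\<close> equals \<eta> itself, so the height above 1
  and the pressure balance.\<close>

lemma pres_layer_bound:
  assumes "\<epsilon> > 0" "\<gamma> > 0" "c > 0" "v \<ge> 1 + c * \<epsilon> powr (1 / (\<gamma> + 1))"
  shows "pres \<gamma> \<epsilon> v \<le> c powr (- \<gamma>) * \<epsilon> powr (1 / (\<gamma> + 1))"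
proof -
  have "(v - 1) powr (- \<gamma>) \<le> (c * \<epsilon> powr (1 / (\<gamma> + 1))) powr (- \<gamma>)"
    using assms by (intro powr_mono2') auto
  also have "\<dots> = c powr (- \<gamma>) * \<epsilon> powr (- (\<gamma> / (\<gamma> + 1)))"
    using assms by (simp add: powr_mult powr_powr)
  finally have "pres \<gamma> \<epsilon> v \<le> \<epsilon> * (c powr (- \<gamma>) * \<epsilon> powr (- (\<gamma> / (\<gamma> + 1))))"
    using assms unfolding pres_def by (intro mult_left_mono) auto
  also have "\<dots> = c powr (- \<gamma>) * (\<epsilon> powr 1 * \<epsilon> powr (- (\<gamma> / (\<gamma> + 1))))"
    using assms by simp
  also have "\<epsilon> powr 1 * \<epsilon> powr (- (\<gamma> / (\<gamma> + 1))) = \<epsilon> powr (1 / (\<gamma> + 1))"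
  proof -
    have "1 + - (\<gamma> / (\<gamma> + 1)) = 1 / (\<gamma> + 1)" using assms by (simp add: field_simps)
    then show ?thesis by (simp only: powr_add[symmetric])
  qed
  finally show ?thesis .
qed

text \<open>The difference of the squared speeds is an explicit fraction whose numerator is
  \<open>O(\<delta> + \<epsilon>)\<close> and whose denominator stays away from 0. Dividing by the
  sum of the speeds, which is at least \<open>sbar vp\<close>, gives the estimate for the
  speeds.\<close>

lemma speed_asymptotics:
  fixes \<gamma> vp :: real
  assumes g: "\<gamma> \<ge> 1" and vp: "vp > 1"
  obtains A where "A > 0"
    "\<forall>\<^sub>F \<epsilon> in at_right 0. 1 < vminus \<gamma> \<epsilon> \<and> vminus \<gamma> \<epsilon> < vp \<and>
       pres \<gamma> \<epsilon> vp \<le> 1 \<and> sbar vp / 2 \<le> speed \<gamma> vp \<epsilon> \<and>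
       \<bar>speed \<gamma> vp \<epsilon> - sbar vp\<bar> \<le> A * \<epsilon> powr (1 / (\<gamma> + 1)) \<and>
       pres \<gamma> \<epsilon> vp \<le> A * \<epsilon> powr (1 / (\<gamma> + 1))"
proof -
  define D where "D = vp - 1"
  define B where "B = D powr (- \<gamma>)"
  \<comment> \<open>The first summand serves the speed, the second the pressure at
    \<open>vp\<close>.\<close>
  define A where "A = (1 + B * D) * (2 / D\<^sup>2) / sbar vp + B"
  have D: "D > 0" and B: "B > 0" using vp unfolding D_def B_def by auto
  have sb: "sbar vp > 0" using sbar_pos vp by simp
  have A: "A > 0" unfolding A_def using D B sb by (intro add_pos_pos divide_pos_pos mult_pos_pos) auto
  \<comment> \<open>These keep \<open>vminus\<close> at distance at least \<open>D / 2\<close> from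
    \<open>vp\<close>, keep the pressure at \<open>vp\<close> below 1/2, and allow powers of
    \<epsilon> to be compared.\<close>
  have ev1: "\<forall>\<^sub>F \<epsilon> in at_right 0. \<epsilon> powr (1 / \<gamma>) \<le> D / 2"
    and ev2: "\<forall>\<^sub>F \<epsilon> in at_right 0. \<epsilon> powr 1 \<le> 1 / (2 * B)"
    and ev3: "\<forall>\<^sub>F \<epsilon> in at_right (0::real). \<epsilon> powr 1 \<le> 1"
    by (rule powr_eventually_le; use g D B in simp)+
  have ev4: "\<forall>\<^sub>F \<epsilon> in at_right 0. (0::real) < \<epsilon>" by (rule eventually_at_right_less)
  from ev1 ev2 ev3 ev4 have "\<forall>\<^sub>F \<epsilon> in at_right 0. 1 < vminus \<gamma> \<epsilon> \<and> vminus \<gamma> \<epsilon> < vp \<and>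
       pres \<gamma> \<epsilon> vp \<le> 1 \<and> sbar vp / 2 \<le> speed \<gamma> vp \<epsilon> \<and>
       \<bar>speed \<gamma> vp \<epsilon> - sbar vp\<bar> \<le> A * \<epsilon> powr (1 / (\<gamma> + 1)) \<and>
       pres \<gamma> \<epsilon> vp \<le> A * \<epsilon> powr (1 / (\<gamma> + 1))"
  proof eventually_elim
    case (elim \<epsilon>)
    define \<delta> where "\<delta> = \<epsilon> powr (1 / \<gamma>)"
    define \<eta> where "\<eta> = \<epsilon> powr (1 / (\<gamma> + 1))"
    define q where "q = pres \<gamma> \<epsilon> vp"
    define s where "s = speed \<gamma> vp \<epsilon>"
    have e: "0 < \<epsilon>" "\<epsilon> \<le> 1" using elim by auto
    have \<delta>: "0 < \<delta>" "\<delta> \<le> D / 2" using e elim by (auto simp: \<delta>_def)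
    have \<delta>\<eta>: "\<delta> \<le> \<eta>" and e\<eta>: "\<epsilon> \<le> \<eta>"
      using powr_exponent_le[OF e, of \<gamma>] g unfolding \<delta>_def \<eta>_def by auto
    have qe: "q = B * \<epsilon>" unfolding q_def pres_def B_def D_def by simp
    have q: "0 < q" "q \<le> 1 / 2" "q \<le> B * \<eta>"
      using e B elim e\<eta> unfolding qe by (auto simp: field_simps)
    have vm: "1 < vminus \<gamma> \<epsilon>" "vminus \<gamma> \<epsilon> < vp" and vmD: "vp - vminus \<gamma> \<epsilon> = D - \<delta>"
      using \<delta> D unfolding vminus_def \<delta>_def[symmetric] D_def by auto
    have s2: "s\<^sup>2 = (1 - q) / (D - \<delta>)"
      using speed_squared[of \<epsilon> \<gamma> vp] e g q vm unfolding s_def q_def[symmetric] vmD by simp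
    have s0: "s \<ge> 0"
      unfolding s_def speed_def using q vm e g
      by (auto simp: pres_vminus q_def[symmetric] divide_nonpos_pos)
    have sb2: "(sbar vp)\<^sup>2 = 1 / D" using sbar_squared vp unfolding D_def by simp
    have "(sbar vp / 2)\<^sup>2 \<le> s\<^sup>2"
    proof -
      have "(sbar vp / 2)\<^sup>2 = (1 / 4) / D" using sb2 by (simp add: power_divide)
      also have "\<dots> \<le> (1 - q) / (D - \<delta>)" using q \<delta> D by (intro frac_le) auto
      finally show ?thesis using s2 by simp
    qed
    then have sh: "sbar vp / 2 \<le> s" using s0 by (rule power2_le_imp_le)
    have eq2: "s\<^sup>2 - (sbar vp)\<^sup>2 = (\<delta> - q * D) / ((D - \<delta>) * D)"
      unfolding s2 sb2 using \<delta> D by (simp add: field_simps)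
    have "\<bar>\<delta> - q * D\<bar> \<le> (1 + B * D) * \<eta>"
    proof -
      have "\<bar>\<delta> - q * D\<bar> \<le> \<delta> + q * D" using \<delta> q D by (simp add: abs_if)
      also have "\<dots> \<le> \<eta> + (B * \<eta>) * D" using \<delta>\<eta> q D by (intro add_mono mult_right_mono) auto
      finally show ?thesis by (simp add: algebra_simps)
    qed
    moreover have "D\<^sup>2 / 2 \<le> (D - \<delta>) * D"
      using mult_right_mono[of "D / 2" "D - \<delta>" D] \<delta> D by (simp add: power2_eq_square)
    ultimately have "\<bar>\<delta> - q * D\<bar> / ((D - \<delta>) * D) \<le> (1 + B * D) * \<eta> / (D\<^sup>2 / 2)"
      using D by (intro frac_le) auto
    then have d2: "\<bar>s\<^sup>2 - (sbar vp)\<^sup>2\<bar> \<le> (1 + B * D) * \<eta> / (D\<^sup>2 / 2)"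
      using eq2 \<delta> D by (simp add: abs_mult)
    have "\<bar>s - sbar vp\<bar> * sbar vp \<le> \<bar>s - sbar vp\<bar> * (s + sbar vp)"
      using s0 by (intro mult_left_mono) auto
    also have "\<dots> = \<bar>s\<^sup>2 - (sbar vp)\<^sup>2\<bar>"
      using s0 sb by (simp add: power2_eq_square square_diff_square_factored abs_mult)
    also note d2
    finally have "\<bar>s - sbar vp\<bar> \<le> (1 + B * D) * \<eta> / (D\<^sup>2 / 2) / sbar vp"
      using sb by (simp only: pos_le_divide_eq)
    also have "\<dots> = (1 + B * D) * (2 / D\<^sup>2) / sbar vp * \<eta>" by simp
    also have "\<dots> \<le> A * \<eta>"
      unfolding A_def using B e by (intro mult_right_mono) (auto simp: \<eta>_def)
    finally have ds: "\<bar>s - sbar vp\<bar> \<le> A * \<eta>" .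
    have "B * \<eta> \<le> A * \<eta>"
      unfolding A_def using B D sb by (intro mult_right_mono) (auto simp: \<eta>_def)
    then show ?case using vm q sh ds unfolding s_def q_def \<eta>_def by auto
  qed
  with A show thesis by (rule that)
qed

section \<open>Sign and size of the right-hand side of the profile ODE\<close>

text \<open>The pressure has nonnegative second derivative on \<open>{1<..}\<close>, hence is convex
  there. The chord is anchored at \<open>b\<close> to match the form of
  \<open>front_rhs\<close>.\<close>

lemma pres_below_chord:
  assumes "\<epsilon> > 0" "\<gamma> > 0" "1 < a" "a \<le> v" "v \<le> b" "a < b"
  shows "pres \<gamma> \<epsilon> v \<le> (pres \<gamma> \<epsilon> b - pres \<gamma> \<epsilon> a) / (b - a) * (v - b) + pres \<gamma> \<epsilon> b"
proof -
  have "convex_on {1<..} (pres \<gamma> \<epsilon>)"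
  proof (rule f''_ge0_imp_convex)
    show "(pres \<gamma> \<epsilon> has_real_derivative \<epsilon> * (- \<gamma> * (x - 1) powr (- \<gamma> - 1))) (at x)"
      if "x \<in> {1<..}" for x
      unfolding pres_def using that by (auto intro!: derivative_eq_intros)
    show "((\<lambda>x. \<epsilon> * (- \<gamma> * (x - 1) powr (- \<gamma> - 1))) has_real_derivative
        \<epsilon> * (\<gamma> * (\<gamma> + 1) * (x - 1) powr (- \<gamma> - 2))) (at x)"
      if "x \<in> {1<..}" for x
      using that by (auto intro!: derivative_eq_intros simp: algebra_simps)
  qed (use assms in auto)
  then have "convex_on {a..b} (pres \<gamma> \<epsilon>)"
    by (rule convex_on_subset) (use assms in auto)
  from convex_onD_Icc''[OF this] assms
  have "pres \<gamma> \<epsilon> v \<le> (pres \<gamma> \<epsilon> a - pres \<gamma> \<epsilon> b) / (b - a) * (b - v) + pres \<gamma> \<epsilon> b"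
    by auto
  also have "(pres \<gamma> \<epsilon> a - pres \<gamma> \<epsilon> b) / (b - a) * (b - v) =
      (pres \<gamma> \<epsilon> b - pres \<gamma> \<epsilon> a) / (b - a) * (v - b)"
    using assms by (simp add: field_simps)
  finally show ?thesis .
qed

text \<open>Minus the squared speed is the slope of the chord of the pressure between the end
  states, so the bracket in \<open>front_rhs\<close> is the gap between chord and graph. This makes
  the profile monotone.\<close>

lemma front_rhs_nonneg:
  assumes "\<epsilon> > 0" "\<gamma> > 0" "\<mu> > 0" "speed \<gamma> vp \<epsilon> > 0" "pres \<gamma> \<epsilon> vp \<le> 1"
    "vminus \<gamma> \<epsilon> < vp" "1 < vminus \<gamma> \<epsilon>" "vminus \<gamma> \<epsilon> \<le> v" "v \<le> vp"
  shows "front_rhs \<mu> \<gamma> vp \<epsilon> v \<ge> 0"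
proof -
  have "pres \<gamma> \<epsilon> v \<le> (pres \<gamma> \<epsilon> vp - 1) / (vp - vminus \<gamma> \<epsilon>) * (v - vp) + pres \<gamma> \<epsilon> vp"
    using pres_below_chord[of \<epsilon> \<gamma> "vminus \<gamma> \<epsilon>" v vp] assms by (simp add: pres_vminus)
  also have "(pres \<gamma> \<epsilon> vp - 1) / (vp - vminus \<gamma> \<epsilon>) * (v - vp) = (speed \<gamma> vp \<epsilon>)\<^sup>2 * (vp - v)"
    using assms by (simp add: speed_squared field_simps)
  finally show ?thesis
    unfolding front_rhs_def using assms by (intro mult_nonneg_nonneg) auto
qed

lemma front_rhs_upper:
  assumes "\<mu> > 0" "sbar vp / 2 \<le> s" "s \<le> S" "pres \<gamma> \<epsilon> vp \<le> 1" "\<epsilon> > 0" "1 \<le> v" "v \<le> vp" "vp > 1"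
    "s = speed \<gamma> vp \<epsilon>"
  shows "front_rhs \<mu> \<gamma> vp \<epsilon> v \<le> vp / \<mu> * (S * vp + 2 / sbar vp)"
proof -
  have sb: "sbar vp > 0" using sbar_pos assms by simp
  have s0: "s > 0" using assms sb by linarith
  have p0: "pres \<gamma> \<epsilon> x \<ge> 0" for x using assms by (simp add: pres_def)
  have eq: "front_rhs \<mu> \<gamma> vp \<epsilon> v = v / \<mu> * (s * (vp - v) + (pres \<gamma> \<epsilon> vp - pres \<gamma> \<epsilon> v) / s)"
    unfolding front_rhs_def assms(9)[symmetric] using s0 assms(1)
    by (simp add: field_simps power2_eq_square)
  have "(pres \<gamma> \<epsilon> vp - pres \<gamma> \<epsilon> v) / s \<le> 1 / (sbar vp / 2)"
    using p0[of v] p0[of vp] assms sb by (intro frac_le) auto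
  moreover have "s * (vp - v) \<le> S * vp" using assms s0 by (intro mult_mono) auto
  ultimately have 1: "s * (vp - v) + (pres \<gamma> \<epsilon> vp - pres \<gamma> \<epsilon> v) / s \<le> S * vp + 2 / sbar vp"
    by simp
  have "v / \<mu> * (s * (vp - v) + (pres \<gamma> \<epsilon> vp - pres \<gamma> \<epsilon> v) / s) \<le> v / \<mu> * (S * vp + 2 / sbar vp)"
    using 1 assms by (intro mult_left_mono) auto
  also have "\<dots> \<le> vp / \<mu> * (S * vp + 2 / sbar vp)"
    using assms sb s0 by (intro mult_right_mono divide_right_mono add_nonneg_nonneg) auto
  finally show ?thesis unfolding eq .
qed

text \<open>After one factor \<open>s\<close> cancels, the difference splits into a speed error and
  a pressure difference divided by \<open>s\<close>. Both are \<open>O(\<eta>)\<close> once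
  \<open>v - 1\<close> is at least of order \<eta>.\<close>

lemma front_rhs_logistic:
  assumes "\<mu> > 0" "\<gamma> > 0" "sbar vp / 2 \<le> s" "\<epsilon> > 0" "c > 0" "vp > 1" "A > 0"
    "s = speed \<gamma> vp \<epsilon>" "\<eta> = \<epsilon> powr (1 / (\<gamma> + 1))"
    "\<bar>s - sbar vp\<bar> \<le> A * \<eta>" "pres \<gamma> \<epsilon> vp \<le> A * \<eta>" "1 + c * \<eta> \<le> v" "v \<le> vp"
  shows "\<bar>front_rhs \<mu> \<gamma> vp \<epsilon> v - sbar vp / \<mu> * v * (vp - v)\<bar>
    \<le> vp / \<mu> * (A * vp + (A + c powr (- \<gamma>)) * (2 / sbar vp)) * \<eta>"
proof -
  have sb: "sbar vp > 0" using sbar_pos assms by simp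
  have s0: "s > 0" using assms sb by linarith
  have \<eta>0: "\<eta> > 0" using assms by simp
  then have v1: "v \<ge> 1" using assms by (smt (verit) mult_pos_pos)
  have p0: "pres \<gamma> \<epsilon> x \<ge> 0" for x using assms by (simp add: pres_def)
  have pv: "pres \<gamma> \<epsilon> v \<le> c powr (- \<gamma>) * \<eta>" using pres_layer_bound[of \<epsilon> \<gamma> c v] assms by simp
  have eq: "front_rhs \<mu> \<gamma> vp \<epsilon> v - sbar vp / \<mu> * v * (vp - v) =
      v / \<mu> * ((s - sbar vp) * (vp - v) + (pres \<gamma> \<epsilon> vp - pres \<gamma> \<epsilon> v) / s)"
    unfolding front_rhs_def assms(8)[symmetric] using s0 assms(1)
    by (simp add: field_simps power2_eq_square)
  have "\<bar>(s - sbar vp) * (vp - v)\<bar> \<le> (A * \<eta>) * vp"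
    unfolding abs_mult using assms v1 \<eta>0 by (intro mult_mono) auto
  moreover have "\<bar>(pres \<gamma> \<epsilon> vp - pres \<gamma> \<epsilon> v) / s\<bar> \<le> ((A + c powr (- \<gamma>)) * \<eta>) / (sbar vp / 2)"
  proof -
    have "\<bar>pres \<gamma> \<epsilon> vp - pres \<gamma> \<epsilon> v\<bar> \<le> (A + c powr (- \<gamma>)) * \<eta>"
      using pv p0[of v] p0[of vp] assms(11) by (simp add: distrib_right)
    then show ?thesis unfolding abs_divide using assms s0 sb by (intro frac_le) auto
  qed
  ultimately have "\<bar>(s - sbar vp) * (vp - v) + (pres \<gamma> \<epsilon> vp - pres \<gamma> \<epsilon> v) / s\<bar>
      \<le> (A * \<eta>) * vp + ((A + c powr (- \<gamma>)) * \<eta>) / (sbar vp / 2)"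
    by linarith
  also have "\<dots> = (A * vp + (A + c powr (- \<gamma>)) * (2 / sbar vp)) * \<eta>"
    by (simp add: field_simps)
  finally have 1: "\<bar>(s - sbar vp) * (vp - v) + (pres \<gamma> \<epsilon> vp - pres \<gamma> \<epsilon> v) / s\<bar>
      \<le> (A * vp + (A + c powr (- \<gamma>)) * (2 / sbar vp)) * \<eta>" .
  have "\<bar>front_rhs \<mu> \<gamma> vp \<epsilon> v - sbar vp / \<mu> * v * (vp - v)\<bar>
      \<le> vp / \<mu> * ((A * vp + (A + c powr (- \<gamma>)) * (2 / sbar vp)) * \<eta>)"
    unfolding eq abs_mult using 1 v1 assms
    by (intro mult_mono) (auto simp: divide_right_mono)
  then show ?thesis by (simp add: mult.assoc)
qed

section \<open>Gronwall estimate and the logistic limit equation\<close>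

text \<open>Working with \<open>(e x)\<^sup>2 + \<eta>\<^sup>2\<close> avoids differentiating the
  absolute value. The inhomogeneous term is absorbed by
  \<open>2 * \<eta> * \<bar>e\<bar> \<le> e\<^sup>2 + \<eta>\<^sup>2\<close>, which accounts for the
  rate \<open>2 * L + A\<close>.\<close>

lemma gronwall_affine:
  fixes e e' :: "real \<Rightarrow> real"
  assumes der: "\<And>x. 0 \<le> x \<Longrightarrow> (e has_real_derivative e' x) (at x)"
    and growth: "\<And>x. 0 \<le> x \<Longrightarrow> e x * e' x \<le> L * (e x)\<^sup>2 + A * \<eta> * \<bar>e x\<bar>"
    and "A \<ge> 0" "L \<ge> 0" "0 \<le> x"
  shows "(e x)\<^sup>2 + \<eta>\<^sup>2 \<le> ((e 0)\<^sup>2 + \<eta>\<^sup>2) * exp ((2 * L + A) * x)"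
proof -
  define K where "K = 2 * L + A"
  define G where "G = (\<lambda>x. ((e x)\<^sup>2 + \<eta>\<^sup>2) * exp (- K * x))"
  have "G x \<le> G 0"
  proof (rule DERIV_nonpos_imp_nonincreasing[OF \<open>0 \<le> x\<close>])
    fix t assume t: "0 \<le> t" "t \<le> x"
    have "(G has_real_derivative (2 * (e t * e' t) - K * ((e t)\<^sup>2 + \<eta>\<^sup>2)) * exp (- K * t)) (at t)"
      unfolding G_def using der[OF t(1)]
      by (auto intro!: derivative_eq_intros simp: algebra_simps)
    moreover have "2 * (e t * e' t) \<le> K * ((e t)\<^sup>2 + \<eta>\<^sup>2)"
    proof -
      have "2 * (\<eta> * \<bar>e t\<bar>) \<le> (e t)\<^sup>2 + \<eta>\<^sup>2"
        using sum_squares_bound[of \<eta> "\<bar>e t\<bar>"] by (simp add: mult.assoc)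
      then have "A * (2 * (\<eta> * \<bar>e t\<bar>)) \<le> A * ((e t)\<^sup>2 + \<eta>\<^sup>2)"
        using \<open>A \<ge> 0\<close> by (rule mult_left_mono)
      moreover have "0 \<le> 2 * (L * \<eta>\<^sup>2)" using \<open>L \<ge> 0\<close> by simp
      ultimately show ?thesis
        using growth[OF t(1)] unfolding K_def by (simp add: algebra_simps)
    qed
    ultimately show "\<exists>y. (G has_real_derivative y) (at t) \<and> y \<le> 0"
      by (meson diff_le_0_iff_le exp_ge_zero mult_nonpos_nonneg)
  qed
  then have "((e x)\<^sup>2 + \<eta>\<^sup>2) * exp (- K * x) * exp (K * x) \<le> ((e 0)\<^sup>2 + \<eta>\<^sup>2) * exp (K * x)"
    unfolding G_def by (intro mult_right_mono) auto
  then show ?thesis unfolding K_def[symmetric] by (simp add: mult.assoc exp_add[symmetric])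
qed

text \<open>The right branch of \<^const>\<open>vbar\<close>, continued to the whole line so that it is differentiable
  at 0.\<close>

definition logistic :: "real \<Rightarrow> real \<Rightarrow> real \<Rightarrow> real" where
  "logistic \<mu> vp \<xi> = vp / (1 + (vp - 1) * exp (- (vp / (\<mu> * sqrt (vp - 1))) * \<xi>))"

lemma logistic_pos: "vp > 1 \<Longrightarrow> logistic \<mu> vp \<xi> > 0"
  by (simp add: logistic_def add_pos_pos)

text \<open>This is the formal limit of the profile ODE: \<open>front_rhs\<close> with speed
  \<open>sbar vp\<close> and zero pressure.\<close>

lemma logistic_derivative:
  assumes "vp > 1" "\<mu> > 0"
  shows "(logistic \<mu> vp has_real_derivative
    sbar vp / \<mu> * logistic \<mu> vp x * (vp - logistic \<mu> vp x)) (at x)"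
proof -
  define r where "r = vp / (\<mu> * sqrt (vp - 1))"
  define E where "E = exp (- r * x)"
  define n where "n = 1 + (vp - 1) * E"
  have n: "n > 0" using assms by (simp add: n_def E_def add_pos_pos)
  have r: "r = sbar vp / \<mu> * vp" unfolding r_def using assms by (simp add: sbar_eq)
  have "(logistic \<mu> vp has_real_derivative
      (vp * ((vp - 1) * (r * E))) / n\<^sup>2) (at x)"
    unfolding logistic_def r_def[symmetric] E_def n_def
    using n[unfolded n_def E_def]
    by (auto intro!: derivative_eq_intros simp: power2_eq_square)
  moreover have "vp - vp / n = vp * (vp - 1) * E / n"
    using n by (simp add: field_simps n_def)
  then have "sbar vp / \<mu> * (vp / n) * (vp - vp / n) = (vp * ((vp - 1) * (r * E))) / n\<^sup>2"
    by (simp add: r power2_eq_square mult_ac)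
  ultimately show ?thesis
    unfolding logistic_def r_def[symmetric] E_def[symmetric] n_def[symmetric] by simp
qed

section \<open>Growth of the rescaled layer solution\<close>

text \<open>While \<open>w\<close> stays above 2, its slope is at least the positive slope it has at
  height 2; and it cannot fall below 2, since it would have to leave that level with positive
  slope.\<close>

lemma tilde_solution_linear_growth:
  fixes w :: "real \<Rightarrow> real"
  assumes "tilde_solution \<mu> \<gamma> vp w" "\<mu> > 0" "vp > 1" "\<gamma> > 0" "z \<ge> 0"
  shows "2 + inverse (\<mu> * sbar vp) * (1 - 2 powr (- \<gamma>)) * z \<le> w z"
proof -
  define B where "B = inverse (\<mu> * sbar vp)"
  define c where "c = B * (1 - 2 powr (- \<gamma>))"
  have B: "B > 0" using assms sbar_pos by (simp add: B_def)
  have p2: "2 powr (- \<gamma>) < (1::real)" using powr_less_mono[of "-\<gamma>" 0 2] assms by simp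
  have c: "c > 0" using B p2 by (simp add: c_def)
  have w0: "w 0 = 2" and der: "(w has_real_derivative B * (1 - w z powr (- \<gamma>))) (at z)" for z
    using assms(1) unfolding tilde_solution_def B_def by auto
  have cont: "continuous_on S w" for S
    using der by (meson DERIV_continuous continuous_at_imp_continuous_on)
  have ge2: "w z \<ge> 2" if "z \<ge> 0" for z
  proof (rule ccontr)
    assume "\<not> w z \<ge> 2"
    then have z: "w z < 2" by simp
    \<comment> \<open>At the last time in \<open>S\<close> the derivative is positive, so slightly
      later times also lie in \<open>S\<close>. The ODE is only evaluated where \<open>w\<close> is
      at least 2, so the values of \<open>powr\<close> at nonpositive bases never enter.\<close>
    define S where "S = {t \<in> {0..z}. 2 \<le> w t}"
    have "closed {t. 2 \<le> w t}" by (rule closed_Collect_le[OF continuous_on_const cont])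
    then have "compact ({0..z} \<inter> {t. 2 \<le> w t})" by (intro compact_Int_closed) auto
    then have "compact S" by (simp add: S_def Int_def)
    moreover have "S \<noteq> {}" using that w0 unfolding S_def by force
    ultimately obtain t where t: "t \<in> S" "\<And>y. y \<in> S \<Longrightarrow> y \<le> t"
      by (metis compact_attains_sup)
    have t': "0 \<le> t" "t \<le> z" "2 \<le> w t" using t(1) by (auto simp: S_def)
    have tz: "t < z" using t' z by (cases "t = z") auto
    have "w t powr (- \<gamma>) \<le> 2 powr (- \<gamma>)" using t' assms by (intro powr_mono2') auto
    then have "B * (1 - w t powr (- \<gamma>)) > 0" using B p2 by simp
    from DERIV_pos_inc_right[OF der this] obtain d where d: "d > 0"
      "\<And>h. 0 < h \<Longrightarrow> h < d \<Longrightarrow> w t < w (t + h)" by auto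
    define h where "h = min (d / 2) (z - t)"
    have h: "0 < h" "h < d" "t + h \<le> z" using d tz by (auto simp: h_def)
    have "t + h \<in> S" using d(2)[OF h(1,2)] h t' by (auto simp: S_def)
    with t(2) h(1) show False by fastforce
  qed
  have "w 0 - c * 0 \<le> w z - c * z"
  proof (rule DERIV_nonneg_imp_nondecreasing[OF \<open>z \<ge> 0\<close>])
    fix t assume t: "0 \<le> t" "t \<le> z"
    have "w t powr (- \<gamma>) \<le> 2 powr (- \<gamma>)" using ge2[OF t(1)] assms by (intro powr_mono2') auto
    then have "c \<le> B * (1 - w t powr (- \<gamma>))" using B unfolding c_def by simp
    moreover have "((\<lambda>t. w t - c * t) has_real_derivative B * (1 - w t powr (- \<gamma>)) - c) (at t)"
      by (auto intro!: derivative_eq_intros der)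
    ultimately show "\<exists>y. ((\<lambda>t. w t - c * t) has_real_derivative y) (at t) \<and> 0 \<le> y"
      by force
  qed
  then show ?thesis using w0 by (simp add: c_def B_def)
qed

text \<open>Linear growth and the intermediate value theorem on \<open>{0..y / c}\<close>. This
  point provides the shift of the layer solution, and the bound on \<open>z\<close> makes that shift
  \<open>O(\<eta>)\<close>.\<close>

lemma tilde_solution_attains:
  fixes w :: "real \<Rightarrow> real"
  assumes "tilde_solution \<mu> \<gamma> vp w" "\<mu> > 0" "vp > 1" "\<gamma> > 0" "y > 2"
  obtains z where "z > 0" "w z = y"
    "z \<le> y / (inverse (\<mu> * sbar vp) * (1 - 2 powr (- \<gamma>)))"
proof -
  define c where "c = inverse (\<mu> * sbar vp) * (1 - 2 powr (- \<gamma>))"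
  have "2 powr (- \<gamma>) < (1::real)" using powr_less_mono[of "-\<gamma>" 0 2] assms by simp
  then have c: "c > 0" using assms sbar_pos by (simp add: c_def)
  have w0: "w 0 = 2" using assms(1) by (simp add: tilde_solution_def)
  have cont: "continuous_on S w" for S
    using assms(1) unfolding tilde_solution_def
    by (meson DERIV_continuous continuous_at_imp_continuous_on)
  have "y \<le> w (y / c)"
    using tilde_solution_linear_growth[OF assms(1-4), of "y / c", folded c_def] c assms(5)
    by simp
  then obtain z where z: "0 \<le> z" "z \<le> y / c" "w z = y"
    using IVT'[of w 0 y "y / c"] w0 assms(5) c cont by auto
  moreover have "z \<noteq> 0" using z w0 assms(5) by auto
  ultimately show thesis using that[of z] by (simp add: c_def)
qed

section \<open>Assembly of the two estimates\<close>

theorem proposition1p2: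
  fixes \<mu> \<gamma> vp \<kappa> :: real
    and v :: "real \<Rightarrow> real \<Rightarrow> real"
    and vt :: "real \<Rightarrow> real"
  assumes "\<mu> > 0" and "\<gamma> \<ge> 1" and "vp > 1" and "\<kappa> > 0"
    and profile: "\<forall>\<^sub>F \<epsilon> in at_right 0. front_profile \<mu> \<gamma> vp \<epsilon> (v \<epsilon>)"
    and shift: "\<forall>\<^sub>F \<epsilon> in at_right 0. v \<epsilon> 0 = 1 + \<kappa> * \<epsilon> powr (1 / (\<gamma> + 1))"
    and tilde: "tilde_solution \<mu> \<gamma> vp vt"
  shows "\<exists>\<epsilon>0>0.
    (\<forall>R>0. \<exists>C. \<forall>\<epsilon>. 0 < \<epsilon> \<and> \<epsilon> < \<epsilon>0 \<longrightarrow>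
       Linf_norm_on {-R<..<R} (\<lambda>\<xi>. v \<epsilon> \<xi> - vbar \<mu> vp \<xi>)
         \<le> ereal (C * \<epsilon> powr (1 / (\<gamma> + 1)))) \<and>
    (\<exists>(\<xi>s :: real \<Rightarrow> real) (\<xi>min :: real \<Rightarrow> real) C' C.
       C' > 0 \<and> C > 0 \<and>
       \<xi>s \<in> O[at_right 0](\<lambda>\<epsilon>. \<epsilon> powr (1 / (\<gamma> + 1))) \<and>
       \<xi>min \<sim>[at_right 0] (\<lambda>\<epsilon>. - C' * \<epsilon> powr (1 / (\<gamma> + 1))) \<and>
       (\<forall>\<epsilon>. 0 < \<epsilon> \<and> \<epsilon> < \<epsilon>0 \<longrightarrow>
          \<xi>s \<epsilon> < 0 \<and> \<xi>min \<epsilon> < 0 \<and>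
          (\<forall>\<xi>\<in>{\<xi>min \<epsilon>..0}.
             \<bar>v \<epsilon> \<xi> - vbar \<mu> vp \<xi>
                - \<epsilon> powr (1 / \<gamma>) * vt ((\<xi> - \<xi>s \<epsilon>) / \<epsilon> powr (1 / \<gamma>))\<bar>
              \<le> C * \<epsilon> powr (1 / (\<gamma> + 1)) * \<bar>\<xi>\<bar>)))"
proof -
  define B where "B = inverse (\<mu> * sbar vp)"
  define \<eta> where "\<eta> = (\<lambda>\<epsilon>::real. \<epsilon> powr (1 / (\<gamma> + 1)))"
  define \<delta> where "\<delta> = (\<lambda>\<epsilon>::real. \<epsilon> powr (1 / \<gamma>))"
  define F where "F = (\<lambda>x. sbar vp / \<mu> * x * (vp - x))"
  define f where "f = front_rhs \<mu> \<gamma> vp"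
  have sb: "sbar vp > 0" using sbar_pos assms(3) by simp
  have B: "B > 0" using sb assms(1) by (simp add: B_def)
  have g0: "\<gamma> > 0" using assms(2) by simp
  obtain A0 where A0: "A0 > 0"
    and speed: "\<forall>\<^sub>F \<epsilon> in at_right 0. 1 < vminus \<gamma> \<epsilon> \<and> vminus \<gamma> \<epsilon> < vp \<and>
       pres \<gamma> \<epsilon> vp \<le> 1 \<and> sbar vp / 2 \<le> speed \<gamma> vp \<epsilon> \<and>
       \<bar>speed \<gamma> vp \<epsilon> - sbar vp\<bar> \<le> A0 * \<epsilon> powr (1 / (\<gamma> + 1)) \<and>
       pres \<gamma> \<epsilon> vp \<le> A0 * \<epsilon> powr (1 / (\<gamma> + 1))"
    using speed_asymptotics[OF assms(2,3)] by blast
  have small1: "\<forall>\<^sub>F \<epsilon> in at_right (0::real). \<epsilon> powr 1 \<le> 1" by (rule powr_eventually_le) auto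
  \<comment> \<open>The power is \<open>\<delta> / \<eta>\<close>. Hence
    \<open>\<kappa> * \<eta> / \<delta>\<close> is at least 3 and exceeds the initial height 2 of
    the layer solution.\<close>
  have small2: "\<forall>\<^sub>F \<epsilon> in at_right 0. \<epsilon> powr (1 / \<gamma> - 1 / (\<gamma> + 1)) \<le> \<kappa> / 3"
    using g0 assms(4) by (intro powr_eventually_le) (auto simp: field_simps intro!: add_pos_pos)
  \<comment> \<open>All smallness conditions are collected here, so the threshold does not depend on
    \<open>R\<close>.\<close>
  obtain \<epsilon>0 where \<epsilon>0: "\<epsilon>0 > 0" and good: "\<And>\<epsilon>. 0 < \<epsilon> \<Longrightarrow> \<epsilon> < \<epsilon>0 \<Longrightarrow>
      (front_profile \<mu> \<gamma> vp \<epsilon> (v \<epsilon>) \<and> v \<epsilon> 0 = 1 + \<kappa> * \<epsilon> powr (1 / (\<gamma> + 1))) \<and>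
      (1 < vminus \<gamma> \<epsilon> \<and> vminus \<gamma> \<epsilon> < vp \<and>
       pres \<gamma> \<epsilon> vp \<le> 1 \<and> sbar vp / 2 \<le> speed \<gamma> vp \<epsilon> \<and>
       \<bar>speed \<gamma> vp \<epsilon> - sbar vp\<bar> \<le> A0 * \<epsilon> powr (1 / (\<gamma> + 1)) \<and>
       pres \<gamma> \<epsilon> vp \<le> A0 * \<epsilon> powr (1 / (\<gamma> + 1))) \<and>
      \<epsilon> powr 1 \<le> 1 \<and> \<epsilon> powr (1 / \<gamma> - 1 / (\<gamma> + 1)) \<le> \<kappa> / 3"
    using eventually_conj[OF eventually_conj[OF profile shift]
        eventually_conj[OF speed eventually_conj[OF small1 small2]]]
    unfolding eventually_at_right_field by auto
  \<comment> \<open>\<open>M\<close> bounds the slopes of the profile and of the layer solution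
    alike. \<open>A\<close> is the logistic error at height \<open>\<kappa> / 2 * \<eta>\<close>.
    With \<open>M * C' = \<kappa> / 2\<close>, a function of slope at most \<open>M\<close> loses at
    most half of its height \<open>\<kappa> * \<eta>\<close> over the length
    \<open>C' * \<eta>\<close>.\<close>
  define M where "M = vp / \<mu> * ((sbar vp + A0) * vp + 2 / sbar vp) + B"
  define A where
    "A = vp / \<mu> * (A0 * vp + (A0 + (\<kappa> / 2) powr (- \<gamma>)) * (2 / sbar vp))"
  define C' where "C' = \<kappa> / (2 * M)"
  have "vp / \<mu> * ((sbar vp + A0) * vp + 2 / sbar vp) > 0"
    using assms(1,3) sb A0 by (intro mult_pos_pos add_pos_pos divide_pos_pos) auto
  then have M: "M > 0" "B \<le> M" using B unfolding M_def by auto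
  have A: "A > 0"
    unfolding A_def using assms(1,3,4) sb A0 by (intro mult_pos_pos add_pos_pos divide_pos_pos) auto
  have C': "C' > 0" "M * C' = \<kappa> / 2" using M assms(4) by (auto simp: C'_def)
  \<comment> \<open>The matching condition: the logistic slope at height 1 is the slope of the layer
    equation as its variable tends to infinity.\<close>
  have F1: "F 1 = B"
    using sbar_squared[OF assms(3)] sb assms(1,3)
    by (simp add: F_def B_def field_simps power2_eq_square)
  have vbar0: "vbar \<mu> vp \<xi> = 1" if "\<xi> \<le> 0" for \<xi>
    using that assms(3) by (auto simp: vbar_def)
  have vbar_logistic: "vbar \<mu> vp \<xi> = logistic \<mu> vp \<xi>" if "\<xi> \<ge> 0" for \<xi>
    using that by (simp add: vbar_def logistic_def)

  have basic: "\<eta> \<epsilon> > 0 \<and> \<eta> \<epsilon> \<le> 1 \<and> \<delta> \<epsilon> > 0 \<and> v \<epsilon> 0 = 1 + \<kappa> * \<eta> \<epsilon> \<and>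
      \<kappa> * \<eta> \<epsilon> / \<delta> \<epsilon> > 2 \<and> (\<forall>\<xi>. 1 < v \<epsilon> \<xi> \<and> v \<epsilon> \<xi> < vp) \<and>
      (\<forall>\<xi>. (v \<epsilon> has_real_derivative f \<epsilon> (v \<epsilon> \<xi>)) (at \<xi>)) \<and>
      (\<forall>\<xi>. 0 \<le> f \<epsilon> (v \<epsilon> \<xi>) \<and> f \<epsilon> (v \<epsilon> \<xi>) \<le> M) \<and>
      (\<forall>\<xi>. 1 + \<kappa> / 2 * \<eta> \<epsilon> \<le> v \<epsilon> \<xi> \<longrightarrow> \<bar>f \<epsilon> (v \<epsilon> \<xi>) - F (v \<epsilon> \<xi>)\<bar> \<le> A * \<eta> \<epsilon>)"
    if e: "0 < \<epsilon>" "\<epsilon> < \<epsilon>0" for \<epsilon>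
  proof -
    note G = good[OF e]
    have sp: "speed \<gamma> vp \<epsilon> > 0" using G sb by linarith
    have \<eta>: "\<eta> \<epsilon> > 0" "\<eta> \<epsilon> \<le> 1" and \<delta>: "\<delta> \<epsilon> > 0"
      using e G g0 by (auto simp: \<eta>_def \<delta>_def powr_le1)
    have rng: "vminus \<gamma> \<epsilon> < v \<epsilon> \<xi> \<and> v \<epsilon> \<xi> < vp" for \<xi>
      using G unfolding front_profile_def by blast
    have rng1: "1 < v \<epsilon> \<xi> \<and> v \<epsilon> \<xi> < vp" for \<xi> using rng[of \<xi>] G by auto
    have ode: "(v \<epsilon> has_real_derivative f \<epsilon> (v \<epsilon> \<xi>)) (at \<xi>)" for \<xi>
      unfolding f_def using front_profile_ode assms(1,3) sp G by blast
    have "\<delta> \<epsilon> = \<epsilon> powr (1 / \<gamma> - 1 / (\<gamma> + 1)) * \<eta> \<epsilon>"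
      using e by (simp add: \<delta>_def \<eta>_def powr_add[symmetric])
    also have "\<dots> \<le> \<kappa> / 3 * \<eta> \<epsilon>" using G \<eta> by (intro mult_right_mono) auto
    finally have "3 * \<delta> \<epsilon> \<le> \<kappa> * \<eta> \<epsilon>" by simp
    then have ratio: "\<kappa> * \<eta> \<epsilon> / \<delta> \<epsilon> > 2" using \<delta> by (simp add: pos_less_divide_eq)
    have pos: "0 \<le> f \<epsilon> (v \<epsilon> \<xi>)" for \<xi>
      unfolding f_def using front_rhs_nonneg[of \<epsilon> \<gamma> \<mu> vp "v \<epsilon> \<xi>"] G sp e g0 assms(1) rng[of \<xi>]
      by auto
    have "speed \<gamma> vp \<epsilon> \<le> sbar vp + A0"
    proof -
      have "A0 * \<eta> \<epsilon> \<le> A0" using A0 \<eta> by simp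
      then show ?thesis using G unfolding \<eta>_def by linarith
    qed
    then have up: "f \<epsilon> (v \<epsilon> \<xi>) \<le> M" for \<xi>
      using front_rhs_upper[of \<mu> vp "speed \<gamma> vp \<epsilon>" "sbar vp + A0" \<gamma> \<epsilon> "v \<epsilon> \<xi>"]
        G e assms(1,3) rng1[of \<xi>] B unfolding M_def f_def by auto
    have close: "\<bar>f \<epsilon> (v \<epsilon> \<xi>) - F (v \<epsilon> \<xi>)\<bar> \<le> A * \<eta> \<epsilon>"
      if "1 + \<kappa> / 2 * \<eta> \<epsilon> \<le> v \<epsilon> \<xi>" for \<xi>
      unfolding f_def F_def A_def
      by (rule front_rhs_logistic[where s = "speed \<gamma> vp \<epsilon>" and \<epsilon> = \<epsilon>])
        (use that G e g0 assms(1,3,4) A0 rng1[of \<xi>] \<eta>_def in auto)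
    show ?thesis
      using \<eta> \<delta> ratio rng1 ode pos up close G unfolding \<eta>_def by blast
  qed

  \<comment> \<open>The estimate on bounded intervals\<close>
  have part1: "\<exists>C. \<forall>\<epsilon>. 0 < \<epsilon> \<and> \<epsilon> < \<epsilon>0 \<longrightarrow>
       Linf_norm_on {-R<..<R} (\<lambda>\<xi>. v \<epsilon> \<xi> - vbar \<mu> vp \<xi>) \<le> ereal (C * \<epsilon> powr (1 / (\<gamma> + 1)))"
    if R: "R > 0" for R
  proof (intro exI allI impI)
    define L where "L = sbar vp / \<mu> * vp"
    \<comment> \<open>The summand \<kappa> covers the left of 0, the root is the Gronwall factor at
      \<open>R\<close>.\<close>
    define C where "C = \<kappa> + sqrt ((\<kappa>\<^sup>2 + 1) * exp ((2 * L + A) * R))"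
    have L: "L > 0" using sb assms(1,3) by (simp add: L_def)
    fix \<epsilon> :: real
    assume "0 < \<epsilon> \<and> \<epsilon> < \<epsilon>0"
    then have e: "0 < \<epsilon>" "\<epsilon> < \<epsilon>0" by auto
    note b = basic[OF e]
    have mono: "v \<epsilon> x \<le> v \<epsilon> y" if "x \<le> y" for x y
      using b by (intro DERIV_nonneg_imp_nondecreasing[OF that]) blast
    define h where "h = (\<lambda>x. v \<epsilon> x - logistic \<mu> vp x)"
    have hder: "(h has_real_derivative f \<epsilon> (v \<epsilon> x) - F (logistic \<mu> vp x)) (at x)" for x
      unfolding h_def F_def using b logistic_derivative[OF assms(3,1)] by (intro DERIV_diff) auto
    have growth: "h x * (f \<epsilon> (v \<epsilon> x) - F (logistic \<mu> vp x)) \<le> L * (h x)\<^sup>2 + A * \<eta> \<epsilon> * \<bar>h x\<bar>"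
      if x: "0 \<le> x" for x
    proof -
      have vx: "1 < v \<epsilon> x" using b by blast
      have "1 + \<kappa> / 2 * \<eta> \<epsilon> \<le> v \<epsilon> 0" using b assms(4) by simp
      with mono[OF x] have "1 + \<kappa> / 2 * \<eta> \<epsilon> \<le> v \<epsilon> x" by linarith
      then have close: "\<bar>f \<epsilon> (v \<epsilon> x) - F (v \<epsilon> x)\<bar> \<le> A * \<eta> \<epsilon>" using b by blast
      have "h x * (f \<epsilon> (v \<epsilon> x) - F (v \<epsilon> x)) \<le> \<bar>h x\<bar> * \<bar>f \<epsilon> (v \<epsilon> x) - F (v \<epsilon> x)\<bar>"
        by (metis abs_ge_self abs_mult)
      also have "\<dots> \<le> \<bar>h x\<bar> * (A * \<eta> \<epsilon>)" using close by (intro mult_left_mono) auto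
      finally have 1: "h x * (f \<epsilon> (v \<epsilon> x) - F (v \<epsilon> x)) \<le> A * \<eta> \<epsilon> * \<bar>h x\<bar>" by (simp add: mult_ac)
      \<comment> \<open>\<open>F\<close> is quadratic, so the difference factors exactly. Only an
        upper bound on the factor is required, and positivity of both values gives
        \<open>L\<close>.\<close>
      have "h x * (F (v \<epsilon> x) - F (logistic \<mu> vp x))
          = (sbar vp / \<mu> * (vp - v \<epsilon> x - logistic \<mu> vp x)) * (h x)\<^sup>2"
        unfolding h_def F_def using assms(1) by (simp add: field_simps power2_eq_square)
      also have "\<dots> \<le> L * (h x)\<^sup>2"
        unfolding L_def using sb assms(1) vx logistic_pos[OF assms(3), of \<mu> x]
        by (intro mult_right_mono mult_left_mono) (auto simp: less_imp_le add_nonneg_nonneg)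
      finally show ?thesis using 1 by (simp add: algebra_simps)
    qed
    have h0: "h 0 = \<kappa> * \<eta> \<epsilon>" using b assms(3) by (simp add: h_def logistic_def)
    have "\<bar>v \<epsilon> x - vbar \<mu> vp x\<bar> \<le> C * \<eta> \<epsilon>" if x: "x \<in> {-R<..<R}" for x
    proof (cases "x \<le> 0")
      case True
      have "\<bar>v \<epsilon> x - vbar \<mu> vp x\<bar> \<le> \<kappa> * \<eta> \<epsilon>"
        using mono[OF True] b vbar0[OF True] by (smt (verit))
      also have "\<dots> \<le> C * \<eta> \<epsilon>" using b by (intro mult_right_mono) (auto simp: C_def)
      finally show ?thesis .
    next
      case False
      then have x0: "0 \<le> x" "x \<le> R" using x by auto
      have "(h x)\<^sup>2 + (\<eta> \<epsilon>)\<^sup>2 \<le> ((h 0)\<^sup>2 + (\<eta> \<epsilon>)\<^sup>2) * exp ((2 * L + A) * x)"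
        using gronwall_affine[OF hder growth _ _ x0(1)] A L by simp
      also have "\<dots> \<le> ((h 0)\<^sup>2 + (\<eta> \<epsilon>)\<^sup>2) * exp ((2 * L + A) * R)"
        using x0 A L by (intro mult_left_mono) auto
      also have "\<dots> = ((\<kappa>\<^sup>2 + 1) * exp ((2 * L + A) * R)) * (\<eta> \<epsilon>)\<^sup>2"
        by (simp add: h0 power_mult_distrib algebra_simps)
      finally have "(h x)\<^sup>2 \<le> ((\<kappa>\<^sup>2 + 1) * exp ((2 * L + A) * R)) * (\<eta> \<epsilon>)\<^sup>2"
        using zero_le_power2[of "\<eta> \<epsilon>"] by linarith
      then have "\<bar>h x\<bar> \<le> sqrt (((\<kappa>\<^sup>2 + 1) * exp ((2 * L + A) * R)) * (\<eta> \<epsilon>)\<^sup>2)"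
        by (metis real_sqrt_abs real_sqrt_le_mono)
      also have "\<dots> = sqrt ((\<kappa>\<^sup>2 + 1) * exp ((2 * L + A) * R)) * \<eta> \<epsilon>"
        using b by (simp add: real_sqrt_mult)
      also have "\<dots> \<le> C * \<eta> \<epsilon>"
        using b assms(4) by (intro mult_right_mono) (auto simp: C_def)
      finally show ?thesis using vbar_logistic[OF x0(1)] by (simp add: h_def)
    qed
    then have bound: "\<bar>v \<epsilon> x - vbar \<mu> vp x\<bar> \<le> C * \<eta> \<epsilon>" if "x \<in> {-R<..<R}" for x
      using that by blast
    \<comment> \<open>\<open>esssup\<close> is top on functions that are not measurable, so the
      pointwise bound must be accompanied by measurability.\<close>
    have "continuous_on UNIV (v \<epsilon>)"
      using b by (meson DERIV_continuous continuous_at_imp_continuous_on)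
    then have m1: "v \<epsilon> \<in> borel_measurable borel" by (rule borel_measurable_continuous_onI)
    have m2: "vbar \<mu> vp \<in> borel_measurable borel" unfolding vbar_def by measurable
    have "(\<lambda>x. ereal \<bar>v \<epsilon> x - vbar \<mu> vp x\<bar>) \<in> borel_measurable lborel"
      using m1 m2 by measurable
    then have "(\<lambda>x. ereal \<bar>v \<epsilon> x - vbar \<mu> vp x\<bar>)
        \<in> borel_measurable (restrict_space lborel {-R<..<R})"
      by (rule measurable_restrict_space1)
    then show "Linf_norm_on {-R<..<R} (\<lambda>\<xi>. v \<epsilon> \<xi> - vbar \<mu> vp \<xi>)
        \<le> ereal (C * \<epsilon> powr (1 / (\<gamma> + 1)))"
      unfolding Linf_norm_on_def
      by (rule esssup_I) (use bound in \<open>auto simp: space_restrict_space \<eta>_def intro!: AE_I2\<close>)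
  qed

  \<comment> \<open>The comparison with the layer solution to the left of 0\<close>
  define c where "c = B * (1 - 2 powr (- \<gamma>))"
  have "2 powr (- \<gamma>) < (1::real)" using powr_less_mono[of "-\<gamma>" 0 2] g0 by simp
  then have c: "c > 0" using B by (simp add: c_def)
  have "\<exists>z>0. vt z = \<kappa> * \<eta> \<epsilon> / \<delta> \<epsilon> \<and> z \<le> \<kappa> * \<eta> \<epsilon> / \<delta> \<epsilon> / c"
    if "0 < \<epsilon>" "\<epsilon> < \<epsilon>0" for \<epsilon>
    using tilde_solution_attains[OF tilde assms(1,3) g0, of "\<kappa> * \<eta> \<epsilon> / \<delta> \<epsilon>"] basic[OF that]
    unfolding c_def B_def by metis
  \<comment> \<open>The claimed bound vanishes at 0, so the shift must make both functions agree there.\<close>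
  then obtain Z where Z: "\<And>\<epsilon>. 0 < \<epsilon> \<Longrightarrow> \<epsilon> < \<epsilon>0 \<Longrightarrow>
      Z \<epsilon> > 0 \<and> vt (Z \<epsilon>) = \<kappa> * \<eta> \<epsilon> / \<delta> \<epsilon> \<and> Z \<epsilon> \<le> \<kappa> * \<eta> \<epsilon> / \<delta> \<epsilon> / c"
    by metis
  \<comment> \<open>At position 0 the argument of \<open>vt\<close> is then
    \<open>Z \<epsilon>\<close>, where \<open>\<delta> * vt\<close> equals
    \<open>\<kappa> * \<eta>\<close>.\<close>
  define \<xi>s where "\<xi>s = (\<lambda>\<epsilon>. - (\<delta> \<epsilon> * Z \<epsilon>))"
  \<comment> \<open>One summand for each comparison in \<open>diff\<close> below: profile ODE with
    \<open>F\<close>, \<open>F\<close> with its value at 1, and \<open>B\<close> with the slope of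
    the layer solution.\<close>
  define C where "C = A + sbar vp / \<mu> * vp * \<kappa> + B * (\<kappa> / 2) powr (- \<gamma>)"
  have C: "C > 0"
    unfolding C_def using A sb assms(1,3,4) B by (intro add_pos_nonneg) auto
  have \<xi>s: "\<xi>s \<in> O[at_right 0](\<eta>)"
  proof (rule bigoI)
    have "\<forall>\<^sub>F \<epsilon> in at_right 0. 0 < \<epsilon> \<and> \<epsilon> < \<epsilon>0"
      unfolding eventually_at_right_field using \<epsilon>0 by blast
    then show "\<forall>\<^sub>F \<epsilon> in at_right 0. norm (\<xi>s \<epsilon>) \<le> \<kappa> / c * norm (\<eta> \<epsilon>)"
    proof eventually_elim
      case (elim \<epsilon>)
      then have b: "\<eta> \<epsilon> > 0" "\<delta> \<epsilon> > 0" using basic[of \<epsilon>] by auto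
      have z: "Z \<epsilon> > 0" "Z \<epsilon> \<le> \<kappa> * \<eta> \<epsilon> / \<delta> \<epsilon> / c" using Z[of \<epsilon>] elim by auto
      have "\<delta> \<epsilon> * Z \<epsilon> \<le> \<delta> \<epsilon> * (\<kappa> * \<eta> \<epsilon> / \<delta> \<epsilon> / c)" using z b by (intro mult_left_mono) auto
      also have "\<dots> = \<kappa> / c * \<eta> \<epsilon>" using b by simp
      finally show ?case using b z by (simp add: \<xi>s_def abs_mult)
    qed
  qed
  have layer: "\<xi>s \<epsilon> < 0 \<and> - C' * \<eta> \<epsilon> < 0 \<and>
      (\<forall>\<xi>\<in>{- C' * \<eta> \<epsilon>..0}.
        \<bar>v \<epsilon> \<xi> - vbar \<mu> vp \<xi> - \<delta> \<epsilon> * vt ((\<xi> - \<xi>s \<epsilon>) / \<delta> \<epsilon>)\<bar> \<le> C * \<eta> \<epsilon> * \<bar>\<xi>\<bar>)"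
    if e: "0 < \<epsilon>" "\<epsilon> < \<epsilon>0" for \<epsilon>
  proof (intro conjI ballI)
    note b = basic[OF e] and z = Z[OF e]
    have \<eta>: "\<eta> \<epsilon> > 0" and \<delta>: "\<delta> \<epsilon> > 0" and v0: "v \<epsilon> 0 = 1 + \<kappa> * \<eta> \<epsilon>"
      using b by auto
    have vd: "(v \<epsilon> has_real_derivative f \<epsilon> (v \<epsilon> x)) (at x)"
      and f0: "0 \<le> f \<epsilon> (v \<epsilon> x)" and fM: "f \<epsilon> (v \<epsilon> x) \<le> M"
      and rng: "1 < v \<epsilon> x" "v \<epsilon> x < vp" for x
      using b by blast+
    show "\<xi>s \<epsilon> < 0" "- C' * \<eta> \<epsilon> < 0" using z \<eta> \<delta> C' by (auto simp: \<xi>s_def)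
    fix \<xi>
    assume \<xi>: "\<xi> \<in> {- C' * \<eta> \<epsilon>..0}"
    define y where "y = (\<lambda>x. vt ((x - \<xi>s \<epsilon>) / \<delta> \<epsilon>))"
    \<comment> \<open>Since \<open>vbar\<close> is 1 up to position 0, the claim compares the
      profile with \<open>w\<close>.\<close>
    define w where "w = (\<lambda>x. 1 + \<delta> \<epsilon> * y x)"
    have vtd: "(vt has_real_derivative B * (1 - vt x powr (- \<gamma>))) (at x)" for x
      using tilde unfolding tilde_solution_def B_def by blast
    have wd: "(w has_real_derivative B * (1 - y x powr (- \<gamma>))) (at x)" for x
    proof -
      have "((\<lambda>x. (x - \<xi>s \<epsilon>) / \<delta> \<epsilon>) has_real_derivative 1 / \<delta> \<epsilon>) (at x)"
        using \<delta> by (auto intro!: derivative_eq_intros)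
      from DERIV_chain2[OF vtd this]
      have yd: "(y has_real_derivative B * (1 - y x powr (- \<gamma>)) * (1 / \<delta> \<epsilon>)) (at x)"
        unfolding y_def .
      show ?thesis
        unfolding w_def using \<delta> by (auto intro!: derivative_eq_intros yd)
    qed
    have w0: "w 0 = v \<epsilon> 0" using z b \<delta> by (simp add: w_def y_def \<xi>s_def)
    \<comment> \<open>Stated for an arbitrary \<open>g\<close> so that it applies to both the
      profile and \<open>w\<close>.\<close>
    have lower: "1 + \<kappa> / 2 * \<eta> \<epsilon> \<le> g x"
      if "- C' * \<eta> \<epsilon> \<le> x" "x \<le> 0" "g 0 = v \<epsilon> 0"
        "\<And>x. (g has_real_derivative g' x) (at x)" "\<And>x. g' x \<le> M" for g g' :: "real \<Rightarrow> real" and x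
    proof -
      have "g 0 - M * 0 \<le> g x - M * x"
      proof (rule DERIV_nonpos_imp_nonincreasing[OF that(2)])
        fix t
        have "((\<lambda>t. g t - M * t) has_real_derivative g' t - M) (at t)"
          by (auto intro!: derivative_eq_intros that(4))
        then show "\<exists>y. ((\<lambda>t. g t - M * t) has_real_derivative y) (at t) \<and> y \<le> 0"
          using that(5)[of t] by force
      qed
      moreover have "M * (- C' * \<eta> \<epsilon>) \<le> M * x" using that(1) M by (intro mult_left_mono) auto
      moreover have "M * (- C' * \<eta> \<epsilon>) = - (\<kappa> / 2 * \<eta> \<epsilon>)" using C'(2) by (simp add: mult.assoc[symmetric])
      ultimately show ?thesis using v0 that(3) by linarith
    qed
    have diff: "\<bar>f \<epsilon> (v \<epsilon> x) - B * (1 - y x powr (- \<gamma>))\<bar> \<le> C * \<eta> \<epsilon>"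
      if x: "- C' * \<eta> \<epsilon> \<le> x" "x \<le> 0" for x
    proof -
      have "B * (1 - y x powr (- \<gamma>)) \<le> M" for x
        using B M by (smt (verit) mult_left_le powr_ge_zero)
      then have lw: "1 + \<kappa> / 2 * \<eta> \<epsilon> \<le> w x" using lower[OF x w0 wd] by blast
      have lv: "1 + \<kappa> / 2 * \<eta> \<epsilon> \<le> v \<epsilon> x" using lower[OF x refl vd fM] .
      have uv: "v \<epsilon> x \<le> 1 + \<kappa> * \<eta> \<epsilon>"
        
        unfolding v0[symmetric] by (rule DERIV_nonneg_imp_nondecreasing[OF x(2)]) (use vd f0 in blast)
      have 1: "\<bar>f \<epsilon> (v \<epsilon> x) - F (v \<epsilon> x)\<bar> \<le> A * \<eta> \<epsilon>" using lv b by blast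
      have "F (v \<epsilon> x) - F 1 = sbar vp / \<mu> * (vp - v \<epsilon> x - 1) * (v \<epsilon> x - 1)"
        unfolding F_def using assms(1) by (simp add: field_simps)
      then have "\<bar>F (v \<epsilon> x) - F 1\<bar> = sbar vp / \<mu> * \<bar>vp - v \<epsilon> x - 1\<bar> * \<bar>v \<epsilon> x - 1\<bar>"
        using sb assms(1) by (simp add: abs_mult)
      also have "\<dots> \<le> sbar vp / \<mu> * vp * (\<kappa> * \<eta> \<epsilon>)"
        using sb assms(1,3) uv rng[of x] \<eta> assms(4)
        by (intro mult_mono mult_left_mono) (auto simp: abs_le_iff)
      finally have 2: "\<bar>F (v \<epsilon> x) - B\<bar> \<le> sbar vp / \<mu> * vp * \<kappa> * \<eta> \<epsilon>" by (simp add: F1)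
      \<comment> \<open>The nonlinearity of the layer equation is the pressure at
        \<open>w x\<close>, because \<open>\<delta> powr \<gamma> = \<epsilon>\<close>. The pressure
        bound at height \<open>\<kappa> / 2 * \<eta>\<close> therefore applies to it.\<close>
      have yp: "y x powr (- \<gamma>) \<le> (\<kappa> / 2) powr (- \<gamma>) * \<eta> \<epsilon>"
      proof -
        have y0: "y x > 0"
          using lw \<delta> \<eta> assms(4) by (smt (verit) w_def mult_pos_pos divide_pos_pos zero_less_mult_pos)
        have "\<epsilon> = \<delta> \<epsilon> powr \<gamma>" using e g0 by (simp add: \<delta>_def powr_powr)
        then have "pres \<gamma> \<epsilon> (w x) = y x powr (- \<gamma>)"
          using e \<delta> y0 by (simp add: pres_def w_def powr_mult powr_minus)
        then show ?thesis
          using pres_layer_bound[of \<epsilon> \<gamma> "\<kappa> / 2" "w x"] lw e g0 assms(4) by (simp add: \<eta>_def)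
      qed
      have "\<bar>B - B * (1 - y x powr (- \<gamma>))\<bar> = B * y x powr (- \<gamma>)"
        using B by (simp add: algebra_simps)
      also have "\<dots> \<le> B * (\<kappa> / 2) powr (- \<gamma>) * \<eta> \<epsilon>" using yp B by (simp add: mult.assoc)
      finally have 3: "\<bar>B - B * (1 - y x powr (- \<gamma>))\<bar> \<le> B * (\<kappa> / 2) powr (- \<gamma>) * \<eta> \<epsilon>" .
      have "C * \<eta> \<epsilon> = A * \<eta> \<epsilon> + sbar vp / \<mu> * vp * \<kappa> * \<eta> \<epsilon> + B * (\<kappa> / 2) powr (- \<gamma>) * \<eta> \<epsilon>"
        by (simp add: C_def algebra_simps)
      with 1 2 3 show ?thesis by linarith
    qed
    have "\<bar>v \<epsilon> \<xi> - w \<xi>\<bar> \<le> C * \<eta> \<epsilon> * \<bar>\<xi>\<bar>"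
    proof (cases "\<xi> = 0")
      case False
      then have "\<xi> < 0" using \<xi> by simp
      \<comment> \<open>The difference vanishes at 0, so the mean value theorem turns the slope
        bound \<open>C * \<eta>\<close> into one with the factor
        \<open>\<bar>\<xi>\<bar>\<close>.\<close>
      from MVT2[OF this, of "\<lambda>x. v \<epsilon> x - w x" "\<lambda>x. f \<epsilon> (v \<epsilon> x) - B * (1 - y x powr (- \<gamma>))"]
      obtain t where t: "\<xi> < t" "t < 0"
        "(v \<epsilon> 0 - w 0) - (v \<epsilon> \<xi> - w \<xi>) = (0 - \<xi>) * (f \<epsilon> (v \<epsilon> t) - B * (1 - y t powr (- \<gamma>)))"
        using DERIV_diff[OF vd wd] by blast
      have "\<bar>v \<epsilon> \<xi> - w \<xi>\<bar> = \<bar>(0 - \<xi>) * (f \<epsilon> (v \<epsilon> t) - B * (1 - y t powr (- \<gamma>)))\<bar>"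
        using t(3) w0 by simp
      also have "\<dots> = \<bar>\<xi>\<bar> * \<bar>f \<epsilon> (v \<epsilon> t) - B * (1 - y t powr (- \<gamma>))\<bar>" by (simp add: abs_mult)
      also have "\<dots> \<le> \<bar>\<xi>\<bar> * (C * \<eta> \<epsilon>)"
        using diff[of t] t \<xi> by (intro mult_left_mono) auto
      finally show ?thesis by (simp add: mult.commute)
    qed (simp add: w0)
    then show "\<bar>v \<epsilon> \<xi> - vbar \<mu> vp \<xi> - \<delta> \<epsilon> * vt ((\<xi> - \<xi>s \<epsilon>) / \<delta> \<epsilon>)\<bar> \<le> C * \<eta> \<epsilon> * \<bar>\<xi>\<bar>"
      using vbar0[of \<xi>] \<xi> by (simp add: w_def y_def algebra_simps)
  qed
  have part2: "\<exists>(\<xi>s :: real \<Rightarrow> real) (\<xi>min :: real \<Rightarrow> real) C' C.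
       C' > 0 \<and> C > 0 \<and>
       \<xi>s \<in> O[at_right 0](\<eta>) \<and> \<xi>min \<sim>[at_right 0] (\<lambda>\<epsilon>. - C' * \<eta> \<epsilon>) \<and>
       (\<forall>\<epsilon>. 0 < \<epsilon> \<and> \<epsilon> < \<epsilon>0 \<longrightarrow>
          \<xi>s \<epsilon> < 0 \<and> \<xi>min \<epsilon> < 0 \<and>
          (\<forall>\<xi>\<in>{\<xi>min \<epsilon>..0}.
             \<bar>v \<epsilon> \<xi> - vbar \<mu> vp \<xi> - \<delta> \<epsilon> * vt ((\<xi> - \<xi>s \<epsilon>) / \<delta> \<epsilon>)\<bar> \<le> C * \<eta> \<epsilon> * \<bar>\<xi>\<bar>))"
    \<comment> \<open>The left end of the interval is chosen as \<open>- C' * \<eta>\<close>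
      exactly, so the asymptotic equivalence is reflexivity.\<close>
    by (rule exI[of _ \<xi>s], rule exI[of _ "\<lambda>\<epsilon>. - C' * \<eta> \<epsilon>"], rule exI[of _ C'], rule exI[of _ C])
      (intro conjI allI impI C'(1) C \<xi>s asymp_equiv_refl, (use layer in auto)[3])
  show ?thesis
  proof (intro exI[of _ \<epsilon>0] conjI)
    show "\<epsilon>0 > 0" by (rule \<epsilon>0)
  qed (use part1 in blast, rule part2[unfolded \<eta>_def \<delta>_def])
qed

end
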